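(* Let $n\ge 1$, $T>0$, let $u\in L^1(0,T;\mathrm{Lip}(\mathbb{R}^n))$ be a vector field, with values in $\mathbb{R}^n$, and let the scalar function $\theta\in L^\infty(0,T;L^\infty(\mathbb{R}^n))$ be a solution of the transport equation $$\theta_t+u\cdot\nabla\theta=0\quad\text{on }\mathbb{R}^n\times(0,T),\qquad \theta(x,0)=\theta_0(x).$$ Suppose there exists $\gamma\in(0,\infty)$ such that $\theta_0\in C^{(\log\frac1s)^{-\gamma}}(x_0)$ for some $x_0\in\mathbb{R}^n$. Then $$[\theta(\cdot,t)]_{(\log\frac1s)^{-\gamma};\,\varphi(x_0,t)}=[\theta_0]_{(\log\frac1s)^{-\gamma};\,x_0}\qquad\text{for all }t\in[0,T),$$ where $\varphi(x_0,t)$ denotes the particle trajectory generated by $u$ starting at $x_0$. In particular, $$\sup_{x\in\mathbb{R}^n}[\theta(\cdot,t)]_{(\log\frac1s)^{-\gamma};\,x}=\sup_{x\in\mathbb{R}^n}[\theta_0]_{(\log\frac1s)^{-\gamma};\,x}\qquad\text{for all }t\in[0,T).$$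
   Context: For a modulus of continuity $\delta=\delta(s)$ (a positive function of small $s>0$), a function $f$ on $\mathbb{R}^n$ and a point $x_0\in\mathbb{R}^n$, define $$[f]_{\delta(s);x_0}:=\lim_{r\to0}\ \sup_{x\in B_r(x_0),\,x\ne x_0}\frac{|f(x)-f(x_0)|}{\delta(|x-x_0|)}\in[0,+\infty],$$ where $B_r(x_0)$ is the ball of radius $r$ centred at $x_0$, and $$C^{\delta(s)}(x_0)=\{f\in L^\infty(\mathbb{R}^n)\,:\,[f]_{\delta(s);x_0}<+\infty\}.$$ The notation $(\log\frac1s)^{-\gamma}$ refers to the modulus $\delta(s)=(\log\frac1s)^{-\gamma}$, $0<s<1$. The suprema over $x\in\mathbb{R}^n$ are taken in $[0,+\infty]$. $\mathrm{Lip}(\mathbb{R}^n)$ is the space of Lipschitz continuous vector fields on $\mathbb{R}^n$; $u\in L^1(0,T;\mathrm{Lip}(\mathbb{R}^n))$ means that $u$ is measurable in time, Lipschitz in space, and that $|u(0,t)|$ plus the Lipschitz constant of $u(\cdot,t)$ (which equals $\|\nabla u(t)\|_{L^\infty}$ for a suitable matrix norm) is integrable over $(0,T)$. The particle trajectory mapping $x_0\mapsto\varphi(x_0,t)$ from $\mathbb{R}^n$ to $\mathbb{R}^n$ generated by $u$ is the solution of $$\frac{\partial\varphi(x_0,t)}{\partial t}=u(\varphi(x_0,t),t)\ \text{ on }(0,T),\qquad \varphi(x_0,0)=x_0,$$ i.e. $\varphi(x_0,t)=x_0+\int_0^t u(\varphi(x_0,s),s)\,ds$. The solution $\theta$ of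 the transport equation is understood as the pointwise defined solution transported by the flow, i.e. $\theta(\varphi(x,t),t)=\theta_0(x)$ for all $x\in\mathbb{R}^n$, $t\in[0,T)$. *)

theory Defs
  imports "HOL-Analysis.Analysis"
begin

section \<open>Pointwise seminorms with respect to a modulus of continuity\<close>

text \<open>The ball is punctured, and only the values of \<open>\<delta>\<close> at small positive arguments
  influence the limit.\<close>

definition punctured_sup :: "(real \<Rightarrow> real) \<Rightarrow> (real^'n \<Rightarrow> real) \<Rightarrow> real^'n \<Rightarrow> real \<Rightarrow> ennreal" where
  "punctured_sup \<delta> f x0 r =
     (SUP x \<in> ball x0 r - {x0}. ennreal (\<bar>f x - f x0\<bar> / \<delta> (norm (x - x0))))"

definition pt_seminorm :: "(real \<Rightarrow> real) \<Rightarrow> (real^'n \<Rightarrow> real) \<Rightarrow> real^'n \<Rightarrow> ennreal" where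
  "pt_seminorm \<delta> f x0 = Lim (at_right 0) (punctured_sup \<delta> f x0)"

text \<open>The limit always exists in $[0,\infty]$, because the supremum is monotone in \<open>r\<close>.\<close>

lemma punctured_sup_mono:
  "r \<le> r' \<Longrightarrow> punctured_sup \<delta> f x0 r \<le> punctured_sup \<delta> f x0 r'"
  unfolding punctured_sup_def by (intro SUP_subset_mono) auto

lemma punctured_sup_tendsto_INF:
  "(punctured_sup \<delta> f x0 \<longlongrightarrow> (INF r\<in>{0<..}. punctured_sup \<delta> f x0 r)) (at_right 0)"
proof (rule decreasing_tendsto)
  show "\<forall>\<^sub>F r in at_right 0. (INF r\<in>{0<..}. punctured_sup \<delta> f x0 r) \<le> punctured_sup \<delta> f x0 r"
    using eventually_at_right_less by (rule eventually_mono) (auto intro!: INF_lower)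
next
  fix y assume "(INF r\<in>{0<..}. punctured_sup \<delta> f x0 r) < y"
  then obtain r where r: "r > 0" "punctured_sup \<delta> f x0 r < y"
    by (auto simp: INF_less_iff)
  have "\<forall>\<^sub>F s in at_right 0. s < r"
    using r(1) by (auto simp: eventually_at_right intro: exI[of _ r])
  then show "\<forall>\<^sub>F s in at_right 0. punctured_sup \<delta> f x0 s < y"
  proof (rule eventually_mono)
    fix s assume "s < r"
    then show "punctured_sup \<delta> f x0 s < y"
      using punctured_sup_mono[of s r \<delta> f x0] r(2) by (auto intro: le_less_trans)
  qed
qed

lemma pt_seminorm_eq_INF: "pt_seminorm \<delta> f x0 = (INF r\<in>{0<..}. punctured_sup \<delta> f x0 r)"
  unfolding pt_seminorm_def
  by (rule tendsto_Lim[OF _ punctured_sup_tendsto_INF]) simp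

lemma pt_seminorm_tendsto: "(punctured_sup \<delta> f x0 \<longlongrightarrow> pt_seminorm \<delta> f x0) (at_right 0)"
  unfolding pt_seminorm_eq_INF by (rule punctured_sup_tendsto_INF)

text \<open>Only meaningful for \<open>0 < s < 1\<close>.\<close>

definition log_modulus :: "real \<Rightarrow> real \<Rightarrow> real" where
  "log_modulus \<gamma> s = ln (1 / s) powr (- \<gamma>)"


section \<open>Function spaces\<close>

text \<open>Members of these spaces are functions, not equivalence classes: the seminorm above
  depends on pointwise values.\<close>

definition L_infty :: "(real^'n \<Rightarrow> real) set" where
  "L_infty = {f. f \<in> borel_measurable lebesgue \<and> (\<exists>M. AE x in lebesgue. \<bar>f x\<bar> \<le> M)}"

definition pt_modulus_space :: "(real \<Rightarrow> real) \<Rightarrow> real^'n \<Rightarrow> (real^'n \<Rightarrow> real) set" where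
  "pt_modulus_space \<delta> x0 = {f \<in> L_infty. pt_seminorm \<delta> f x0 < \<infinity>}"

text \<open>$L^\infty(0,T;L^\infty(\mathbb{R}^n))$, with joint Lebesgue measurability.\<close>

definition L_infty_L_infty :: "real \<Rightarrow> (real^'n \<Rightarrow> real \<Rightarrow> real) set" where
  "L_infty_L_infty T = {\<theta>.
     (\<lambda>(x, t). \<theta> x t) \<in> borel_measurable (lebesgue_on (UNIV \<times> {0<..<T})) \<and>
     (\<exists>M. AE t in lebesgue_on {0<..<T}.
        (\<lambda>x. \<theta> x t) \<in> L_infty \<and> (AE x in lebesgue. \<bar>\<theta> x t\<bar> \<le> M))}"

text \<open>The least Lipschitz constant; only meaningful for Lipschitz functions.\<close>

definition lip_const :: "(real^'n \<Rightarrow> real^'n) \<Rightarrow> real" where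
  "lip_const f = Inf {L. L-lipschitz_on UNIV f}"

text \<open>$L^1(0,T;\mathrm{Lip}(\mathbb{R}^n))$; the Lipschitz property is required for almost
  every time only.\<close>

definition L1_Lip :: "real \<Rightarrow> (real^'n \<Rightarrow> real \<Rightarrow> real^'n) set" where
  "L1_Lip T = {u.
     (\<forall>x. (\<lambda>t. u x t) \<in> borel_measurable (lebesgue_on {0<..<T})) \<and>
     (AE t in lebesgue_on {0<..<T}. \<exists>L. L-lipschitz_on UNIV (\<lambda>x. u x t)) \<and>
     (\<lambda>t. norm (u 0 t) + lip_const (\<lambda>x. u x t)) absolutely_integrable_on {0<..<T}}"


section \<open>Particle trajectories and transported functions\<close>

text \<open>The ordinary differential equation is understood in its integrated (Caratheodory) form,
  with a Lebesgue integral.\<close>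

definition particle_trajectory_map ::
  "real \<Rightarrow> (real^'n \<Rightarrow> real \<Rightarrow> real^'n) \<Rightarrow> (real^'n \<Rightarrow> real \<Rightarrow> real^'n) \<Rightarrow> bool" where
  "particle_trajectory_map T u \<phi> \<longleftrightarrow>
     (\<forall>x. \<forall>t\<in>{0..<T}.
        (\<lambda>s. u (\<phi> x s) s) absolutely_integrable_on {0..t} \<and>
        \<phi> x t = x + integral {0..t} (\<lambda>s. u (\<phi> x s) s))"

text \<open>Solutions of $\theta_t + u\cdot\nabla\theta = 0$, $\theta(x,0)=\theta_0(x)$, in the
  pointwise sense: \<open>\<theta>\<close> is constant along the trajectories of \<open>u\<close>.\<close>

definition transported_solution ::
  "real \<Rightarrow> (real^'n \<Rightarrow> real \<Rightarrow> real^'n) \<Rightarrow> (real^'n \<Rightarrow> real) \<Rightarrow> (real^'n \<Rightarrow> real \<Rightarrow> real) \<Rightarrow> bool" where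
  "transported_solution T \<phi> \<theta>0 \<theta> \<longleftrightarrow> (\<forall>x. \<forall>t\<in>{0..<T}. \<theta> (\<phi> x t) t = \<theta>0 x)"

end

theory Submission
  imports Defs "HOL-Real_Asymp.Real_Asymp"
begin

text \<open>
  The logarithmic modulus \<open>\<delta>\<close> varies slowly at \<open>0\<close>: for each constant \<open>C > 0\<close> the quotient
  \<open>\<delta> (C * s) / \<delta> s\<close> tends to \<open>1\<close>. So a map that distorts distances by at most a fixed factor in
  either direction changes the denominators in the seminorm only by factors tending to \<open>1\<close>, and
  the seminorm is preserved exactly, however large that factor is
  (\<open>pt_seminorm_log_modulus_bilipschitz\<close>).

  It remains to see that \<open>\<lambda>x. \<phi> x t\<close> is a bi-Lipschitz bijection of $\mathbb{R}^n$. The distance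
  \<open>\<bar>\<phi> x s - \<phi> y s\<bar>\<close> varies between two times by at most its maximum in between, multiplied by the
  integral of an integrable majorant of the Lipschitz constants. Where that integral is at most
  one half, the distances at the two ends are therefore comparable with factor \<open>2\<close>, and
  \<open>[0, t]\<close> splits into finitely many such intervals (\<open>flow_bilipschitz\<close>). The sharp exponential
  constant of Gronwall's inequality would bring nothing, since any constant will do.

  The seminorm at \<open>\<phi> x0 t\<close> involves all nearby points, and the transport identity speaks of \<open>\<theta>\<close>
  only on the range of \<open>\<lambda>x. \<phi> x t\<close>, so surjectivity is essential. It comes from topology instead of
  from solving the equation backwards in time: a bi-Lipschitz self-map of $\mathbb{R}^n$ has a
  closed range by completeness and an open range by invariance of domain
  (\<open>bilipschitz_imp_surj\<close>). Surjectivity also turns the pointwise identity, which holds at every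
  starting point, into the identity of the suprema.
\<close>


section \<open>Pointwise seminorms under a change of variables\<close>

text \<open>One direction for a general slowly varying modulus. If \<open>y = \<psi> x\<close> lies at distance \<open>s\<close> from
  \<open>\<psi> x0\<close>, then \<open>x\<close> lies within \<open>C * s\<close> of \<open>x0\<close>; so monotonicity gives
  \<open>\<delta> (norm (x - x0)) \<le> \<delta> (C * s) \<le> c * \<delta> s\<close> for each \<open>c > 1\<close> once \<open>s\<close> is small. Only a lower bound
  on the distances between images is assumed, which lets the opposite inequality come from the
  same lemma applied to the inverse map.\<close>

lemma pt_seminorm_le_change_of_variables:
  fixes \<psi> :: "real^'n \<Rightarrow> real^'n"
  assumes C: "C > 0"
    and slow: "((\<lambda>s. \<delta> (C * s) / \<delta> s) \<longlongrightarrow> 1) (at_right 0)"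
    and a: "a > 0"
    and pos: "\<And>s. 0 < s \<Longrightarrow> s < a \<Longrightarrow> \<delta> s > 0"
    and mono: "\<And>s s'. 0 < s \<Longrightarrow> s \<le> s' \<Longrightarrow> s' < a \<Longrightarrow> \<delta> s \<le> \<delta> s'"
    and surj: "surj \<psi>"
    and expand: "\<And>x y. norm (x - y) \<le> C * norm (\<psi> x - \<psi> y)"
    and eq: "\<And>x. f (\<psi> x) = f0 x"
  shows "pt_seminorm \<delta> f (\<psi> x0) \<le> pt_seminorm \<delta> f0 x0"
proof -
  have step: "pt_seminorm \<delta> f (\<psi> x0) \<le> ennreal c * pt_seminorm \<delta> f0 x0" if c: "c > 1" for c
  proof -
    have "\<forall>\<^sub>F s in at_right 0. \<delta> (C * s) / \<delta> s < c"
      using slow c by (rule order_tendstoD)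
    then obtain \<eta> where \<eta>: "\<eta> > 0" "\<And>s. 0 < s \<Longrightarrow> s < \<eta> \<Longrightarrow> \<delta> (C * s) / \<delta> s < c"
      by (auto simp: eventually_at_right_field)
    have "pt_seminorm \<delta> f (\<psi> x0) \<le> ennreal c * punctured_sup \<delta> f0 x0 R" if R: "R > 0" for R
    proof -
      \<comment> \<open>For \<open>s < r\<close> the quotient bound applies, both \<open>s\<close> and \<open>C * s\<close> are in the range where
          \<open>\<delta>\<close> is positive and monotone, and preimages stay in the ball of radius \<open>R\<close>.\<close>
      define r where "r = Min {\<eta>, a, a / C, R / C}"
      have r: "r > 0" "r \<le> \<eta>" "r \<le> a" "r \<le> a / C" "r \<le> R / C"
        using \<eta> a C R by (auto simp: r_def)
      have "pt_seminorm \<delta> f (\<psi> x0) \<le> punctured_sup \<delta> f (\<psi> x0) r"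
        unfolding pt_seminorm_eq_INF using r by (intro INF_lower) auto
      also have "\<dots> \<le> ennreal c * punctured_sup \<delta> f0 x0 R"
        unfolding punctured_sup_def[of \<delta> f]
      proof (rule SUP_least)
        fix y assume y: "y \<in> ball (\<psi> x0) r - {\<psi> x0}"
        obtain x where x: "y = \<psi> x" using surj by (auto elim: surjE)
        define s where "s = norm (y - \<psi> x0)"
        have s: "0 < s" "s < r" using y by (auto simp: s_def dist_norm norm_minus_commute)
        have Cs: "C * s < C * r" using s C by simp
        moreover have "C * r \<le> a" "C * r \<le> R" using r C by (auto simp: field_simps)
        ultimately have Cs: "C * s < a" "C * s < R" by auto
        have xs: "norm (x - x0) \<le> C * s" using expand[of x x0] by (simp add: s_def x)
        have x0: "x \<noteq> x0" using y x by auto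
        then have npos: "norm (x - x0) > 0" by simp
        have d0: "\<delta> s > 0" using s r by (intro pos) auto
        have d1: "\<delta> (norm (x - x0)) > 0" using npos xs Cs by (intro pos) auto
        have "\<delta> (norm (x - x0)) \<le> \<delta> (C * s)" using npos xs Cs by (intro mono) auto
        also have "\<dots> \<le> c * \<delta> s" using \<eta>(2)[of s] s r d0 by (simp add: field_simps)
        finally have d2: "\<delta> (norm (x - x0)) \<le> c * \<delta> s" .
        have "\<bar>f y - f (\<psi> x0)\<bar> / \<delta> s \<le> c * (\<bar>f0 x - f0 x0\<bar> / \<delta> (norm (x - x0)))"
          using mult_left_mono[OF d2, of "\<bar>f0 x - f0 x0\<bar>"] d0 d1
          by (simp add: x eq field_simps)
        then have "ennreal (\<bar>f y - f (\<psi> x0)\<bar> / \<delta> s)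
            \<le> ennreal c * ennreal (\<bar>f0 x - f0 x0\<bar> / \<delta> (norm (x - x0)))"
          using c d1 by (simp add: ennreal_mult[symmetric] ennreal_leI)
        also have "\<dots> \<le> ennreal c * punctured_sup \<delta> f0 x0 R"
          unfolding punctured_sup_def using x0 xs Cs
          by (intro mult_left_mono SUP_upper) (auto simp: dist_norm norm_minus_commute)
        finally show "ennreal (\<bar>f y - f (\<psi> x0)\<bar> / \<delta> (norm (y - \<psi> x0)))
            \<le> ennreal c * punctured_sup \<delta> f0 x0 R" by (simp add: s_def)
      qed
      finally show ?thesis .
    qed
    then have "\<forall>\<^sub>F R in at_right 0. pt_seminorm \<delta> f (\<psi> x0) \<le> ennreal c * punctured_sup \<delta> f0 x0 R"
      by (auto intro: eventually_mono[OF eventually_at_right_less])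
    then show ?thesis
      by (intro tendsto_lowerbound[OF ennreal_tendsto_cmult[OF _ pt_seminorm_tendsto]]) auto
  qed
  \<comment> \<open>Let \<open>c\<close> decrease to \<open>1\<close>; an infinite right-hand side needs no argument.\<close>
  show ?thesis
  proof (cases "pt_seminorm \<delta> f0 x0")
    case (real p)
    have "((\<lambda>c. ennreal (c * p)) \<longlongrightarrow> ennreal (1 * p)) (at_right 1)"
      by (intro tendsto_intros)
    moreover have "\<forall>\<^sub>F c in at_right 1. pt_seminorm \<delta> f (\<psi> x0) \<le> ennreal (c * p)"
      using eventually_at_right_less
    proof eventually_elim
      case (elim c)
      then show ?case using step[of c] real by (simp add: ennreal_mult)
    qed
    ultimately have "pt_seminorm \<delta> f (\<psi> x0) \<le> ennreal (1 * p)"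
      by (rule tendsto_lowerbound) auto
    then show ?thesis using real by simp
  qed auto
qed

text \<open>Replacing \<open>s\<close> by \<open>C * s\<close> changes \<open>ln (1 / s)\<close>, which tends to infinity, by an additive constant
  only. A power of \<open>s\<close> does not have this property: there the limit is a power of \<open>C\<close>.\<close>

lemma log_modulus_slowly_varying:
  assumes "C > 0"
  shows "((\<lambda>s. log_modulus \<gamma> (C * s) / log_modulus \<gamma> s) \<longlongrightarrow> 1) (at_right 0)"
  using assms unfolding log_modulus_def by real_asymp

lemma log_modulus_mono:
  assumes "\<gamma> \<ge> 0" "0 < s" "s \<le> s'" "s' < 1"
  shows "log_modulus \<gamma> s \<le> log_modulus \<gamma> s'"
proof -
  have "ln s \<le> ln s'" "ln s' < 0" using assms by auto
  then show ?thesis using assms by (auto simp: log_modulus_def ln_div intro!: powr_mono2')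
qed

lemma log_modulus_pos:
  assumes "0 < s" "s < 1"
  shows "log_modulus \<gamma> s > 0"
  using assms by (auto simp: log_modulus_def ln_div)

text \<open>The hypotheses are symmetric under exchanging \<open>\<psi>\<close> with its inverse and \<open>f\<close> with \<open>f0\<close>, so
  the previous comparison applies in both directions.\<close>

lemma pt_seminorm_log_modulus_bilipschitz:
  fixes \<psi> :: "real^'n \<Rightarrow> real^'n"
  assumes \<gamma>: "\<gamma> \<ge> 0"
    and C: "C > 0"
    and surj: "surj \<psi>"
    and lower: "\<And>x y. norm (x - y) \<le> C * norm (\<psi> x - \<psi> y)"
    and upper: "\<And>x y. norm (\<psi> x - \<psi> y) \<le> C * norm (x - y)"
    and eq: "\<And>x. f (\<psi> x) = f0 x"
  shows "pt_seminorm (log_modulus \<gamma>) f (\<psi> x0) = pt_seminorm (log_modulus \<gamma>) f0 x0"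
proof (rule antisym)
  have comparison: "pt_seminorm (log_modulus \<gamma>) h (\<rho> z) \<le> pt_seminorm (log_modulus \<gamma>) h0 z"
    if "surj \<rho>" "\<And>x y. norm (x - y) \<le> C * norm (\<rho> x - \<rho> y)" "\<And>x. h (\<rho> x) = h0 x"
    for h h0 :: "real^'n \<Rightarrow> real" and \<rho> :: "real^'n \<Rightarrow> real^'n" and z
  proof (rule pt_seminorm_le_change_of_variables[OF C log_modulus_slowly_varying[OF C] zero_less_one])
    show "log_modulus \<gamma> s > 0" if "0 < s" "s < 1" for s
      using that by (rule log_modulus_pos)
    show "log_modulus \<gamma> s \<le> log_modulus \<gamma> s'" if "0 < s" "s \<le> s'" "s' < 1" for s s'
      using \<gamma> that by (rule log_modulus_mono)
  qed (fact that)+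
  show "pt_seminorm (log_modulus \<gamma>) f (\<psi> x0) \<le> pt_seminorm (log_modulus \<gamma>) f0 x0"
    using surj lower eq by (rule comparison)
  have inj: "inj \<psi>"
  proof (rule injI)
    fix x y assume "\<psi> x = \<psi> y"
    then show "x = y" using lower[of x y] by simp
  qed
  have "pt_seminorm (log_modulus \<gamma>) f0 (inv \<psi> (\<psi> x0)) \<le> pt_seminorm (log_modulus \<gamma>) f (\<psi> x0)"
  proof (rule comparison)
    show "surj (inv \<psi>)" using inj by (rule inj_imp_surj_inv)
    show "norm (x - y) \<le> C * norm (inv \<psi> x - inv \<psi> y)" for x y
      using upper[of "inv \<psi> x" "inv \<psi> y"] by (simp add: surj_f_inv_f[OF surj])
    show "f0 (inv \<psi> x) = f x" for x
      using eq[of "inv \<psi> x"] by (simp add: surj_f_inv_f[OF surj])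
  qed
  then show "pt_seminorm (log_modulus \<gamma>) f0 x0 \<le> pt_seminorm (log_modulus \<gamma>) f (\<psi> x0)"
    by (simp add: inj)
qed


section \<open>Bi-Lipschitz maps of Euclidean space are onto\<close>

text \<open>The range is nonempty, open by invariance of domain, and closed because Cauchy sequences of
  images pull back to Cauchy sequences; connectedness of the space does the rest.\<close>

lemma bilipschitz_imp_surj:
  fixes \<psi> :: "'a::euclidean_space \<Rightarrow> 'a"
  assumes lower: "\<And>x y. norm (x - y) \<le> C * norm (\<psi> x - \<psi> y)"
    and upper: "\<And>x y. norm (\<psi> x - \<psi> y) \<le> C * norm (x - y)"
  shows "surj \<psi>"
proof -
  define D where "D = max C 1"
  have D: "D > 0" "norm (x - y) \<le> D * norm (\<psi> x - \<psi> y)"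
    "norm (\<psi> x - \<psi> y) \<le> D * norm (x - y)" for x y
    using lower[of x y] upper[of x y]
      mult_right_mono[of C D "norm (\<psi> x - \<psi> y)"] mult_right_mono[of C D "norm (x - y)"]
    by (auto simp: D_def)
  have "D-lipschitz_on UNIV \<psi>"
    using D by (auto intro!: lipschitz_onI simp: dist_norm less_imp_le)
  then have cont: "continuous_on UNIV \<psi>" by (rule lipschitz_on_continuous_on)
  have inj: "inj \<psi>"
  proof (rule injI)
    fix x y assume "\<psi> x = \<psi> y"
    then show "x = y" using lower[of x y] by simp
  qed
  have "open (range \<psi>)" using invariance_of_domain[OF cont open_UNIV inj] .
  moreover have "closed (range \<psi>)"
  proof -
    have "complete (range \<psi>)"
      unfolding complete_def
    proof (intro allI impI)
      fix X assume "(\<forall>n. X n \<in> range \<psi>) \<and> Cauchy X"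
      then have X: "Cauchy X" and "\<forall>n. \<exists>x. X n = \<psi> x" by auto
      then obtain w where w: "\<And>n. X n = \<psi> (w n)" by metis
      have "Cauchy w"
      proof (rule metric_CauchyI)
        fix e :: real assume "e > 0"
        then have "e / D > 0" using D by simp
        from metric_CauchyD[OF X this] obtain M
          where M: "\<And>m n. m \<ge> M \<Longrightarrow> n \<ge> M \<Longrightarrow> dist (X m) (X n) < e / D" by blast
        have "dist (w m) (w n) < e" if "m \<ge> M" "n \<ge> M" for m n
          using M[OF that] D(2)[of "w m" "w n"] D(1) by (simp add: w dist_norm field_simps)
        then show "\<exists>M. \<forall>m\<ge>M. \<forall>n\<ge>M. dist (w m) (w n) < e" by blast
      qed
      then obtain l where "w \<longlonglongrightarrow> l" by (auto simp: Cauchy_convergent_iff convergent_def)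
      then have "(\<lambda>n. \<psi> (w n)) \<longlonglongrightarrow> \<psi> l"
        using cont by (auto simp: continuous_on_eq_continuous_at intro: isCont_tendsto_compose)
      then show "\<exists>l\<in>range \<psi>. X \<longlonglongrightarrow> l" unfolding w[symmetric] by blast
    qed
    then show ?thesis by (rule complete_imp_closed)
  qed
  ultimately show ?thesis
    using clopen[of "range \<psi>"] by auto
qed


section \<open>The flow is bi-Lipschitz\<close>

text \<open>The infimum of the admissible Lipschitz constants is itself admissible.\<close>

lemma lip_const_bound:
  fixes f :: "real^'n \<Rightarrow> real^'n"
  assumes "L-lipschitz_on UNIV f"
  shows "norm (f x - f y) \<le> lip_const f * norm (x - y)"
proof (cases "x = y")
  case False
  have "norm (f x - f y) / norm (x - y) \<le> lip_const f"
    unfolding lip_const_def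
  proof (rule cInf_greatest)
    show "{L. L-lipschitz_on UNIV f} \<noteq> {}" using assms by blast
    fix K assume "K \<in> {L. L-lipschitz_on UNIV f}"
    then show "norm (f x - f y) / norm (x - y) \<le> K"
      using False lipschitz_onD[of K UNIV f x y] by (simp add: dist_norm field_simps)
  qed
  then show ?thesis using False by (simp add: field_simps)
qed simp

text \<open>The norm of the field at the origin stays in the majorant \<open>g\<close>: the sum is what is assumed
  integrable, and it dominates the Lipschitz constant. The end points go into the exceptional
  set because the field is controlled on the open time interval only.\<close>

lemma L1_Lip_majorant:
  assumes u: "u \<in> L1_Lip T"
  obtains g N where "g integrable_on {0..T}" "negligible N"
    "\<And>t. t \<in> {0..T} - N \<Longrightarrow> 0 \<le> g t"
    "\<And>t x y. t \<in> {0..T} - N \<Longrightarrow> norm (u x t - u y t) \<le> g t * norm (x - y)"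
proof -
  define g where "g = (\<lambda>t. norm (u 0 t) + lip_const (\<lambda>x. u x t))"
  have "g integrable_on {0<..<T}"
    using u by (auto simp: L1_Lip_def g_def absolutely_integrable_on_def)
  then have "g integrable_on {0..T}"
    using integrable_on_open_interval[of g 0 T] by (simp add: box_real)
  moreover have "AE t in lebesgue. t \<in> {0<..<T} \<longrightarrow> (\<exists>L. L-lipschitz_on UNIV (\<lambda>x. u x t))"
    using u by (auto simp: L1_Lip_def AE_restrict_space_iff)
  then obtain N where N: "N \<in> null_sets lebesgue"
    "{t. \<not> (t \<in> {0<..<T} \<longrightarrow> (\<exists>L. L-lipschitz_on UNIV (\<lambda>x. u x t)))} \<subseteq> N"
    by (auto simp: eventually_ae_filter)
  have "negligible (N \<union> {0, T})" using N by (auto simp: negligible_iff_null_sets)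
  moreover have lip: "\<exists>L. L-lipschitz_on UNIV (\<lambda>x. u x t)" if "t \<in> {0..T} - (N \<union> {0, T})" for t
    proof -
    have "t \<in> {0<..<T}" "t \<notin> N" using that by auto
    then show ?thesis using N(2) by blast
  qed
  have "0 \<le> lip_const (\<lambda>x. u x t)" if "t \<in> {0..T} - (N \<union> {0, T})" for t
    using lip[OF that] unfolding lip_const_def
    by (intro cInf_greatest) (auto simp: lipschitz_on_def)
  then have "0 \<le> g t" if "t \<in> {0..T} - (N \<union> {0, T})" for t
    using that by (simp add: g_def)
  moreover have "norm (u x t - u y t) \<le> g t * norm (x - y)"
    if "t \<in> {0..T} - (N \<union> {0, T})" for t x y
  proof -
    from lip[OF that] obtain L where "L-lipschitz_on UNIV (\<lambda>x. u x t)" by blast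
    from lip_const_bound[OF this, of x y] show ?thesis
      by (simp add: g_def distrib_right add_increasing)
  qed
  ultimately show ?thesis using that by blast
qed

text \<open>A two-sided Gronwall estimate with a non-optimal constant. On an interval of \<open>g\<close>-mass at most
  \<open>1 / 2\<close>, the increments of \<open>D\<close> are at most half the maximum of its norm, so that maximum is at most
  twice the norm at either end point; each of the \<open>n\<close> intervals contributes a factor \<open>2\<close>. Unlike
  the classical differential argument, this needs no derivative of \<open>norm (D s)\<close> and treats both
  directions of time alike.\<close>

lemma norm_comparable_along_integral_curve:
  fixes D F :: "real \<Rightarrow> 'a::euclidean_space"
  assumes t: "0 \<le> t" and N: "negligible N"
    and g: "g integrable_on {0..t}"
    and g0: "\<And>s. s \<in> {0..t} - N \<Longrightarrow> 0 \<le> g s"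
    and F: "F integrable_on {0..t}"
    and D: "\<And>s. s \<in> {0..t} \<Longrightarrow> D s = D 0 + integral {0..s} F"
    and bound: "\<And>s. s \<in> {0..t} - N \<Longrightarrow> norm (F s) \<le> g s * norm (D s)"
    and n: "n > 0"
    and small: "\<And>k. k < n \<Longrightarrow>
      integral {real k * t / real n .. real (Suc k) * t / real n} g \<le> 1 / 2"
  shows "norm (D t) \<le> 2 ^ n * norm (D 0) \<and> norm (D 0) \<le> 2 ^ n * norm (D t)"
proof -
  have cont: "continuous_on {0..t} D"
  proof -
    have "continuous_on {0..t} (\<lambda>s. D 0 + integral {0..s} F)"
      by (intro continuous_intros indefinite_integral_continuous_1 F)
    moreover have "continuous_on {0..t} D \<longleftrightarrow> continuous_on {0..t} (\<lambda>s. D 0 + integral {0..s} F)"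
      by (rule continuous_on_cong[OF refl D])
    ultimately show ?thesis by blast
  qed
  have local: "norm (D c) \<le> 2 * norm (D b) \<and> norm (D b) \<le> 2 * norm (D c)"
    if bc: "0 \<le> b" "b \<le> c" "c \<le> t" and half: "integral {b..c} g \<le> 1 / 2" for b c
  proof -
    have "continuous_on {b..c} (\<lambda>s. norm (D s))"
      using cont bc by (intro continuous_intros) (auto intro: continuous_on_subset)
    then obtain m where m: "m \<in> {b..c}" "\<And>s. s \<in> {b..c} \<Longrightarrow> norm (D s) \<le> norm (D m)"
      using continuous_attains_sup[of "{b..c}" "\<lambda>s. norm (D s)"] bc by auto
    have incr: "norm (D s' - D s) \<le> norm (D m) / 2"
      if s: "b \<le> s" "s \<le> s'" "s' \<le> c" for s s'
    proof -
      \<comment> \<open>Both functions are altered on the null set, so that the bounds hold at every point.\<close>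
      define g' where "g' = (\<lambda>r. if r \<in> N then 0 else g r)"
      define F' where "F' = (\<lambda>r. if r \<in> N then 0 else F r)"
      have gi: "g' integrable_on {b..c}"
        by (rule integrable_spike[OF integrable_on_subinterval[OF g] N]) (use bc in \<open>auto simp: g'_def\<close>)
      have Fi: "F' integrable_on {s..s'}"
        by (rule integrable_spike[OF integrable_on_subinterval[OF F] N])
          (use bc s in \<open>auto simp: F'_def\<close>)
      have gi': "g' integrable_on {s..s'}"
        by (rule integrable_on_subinterval[OF gi]) (use s in auto)
      have g'0: "0 \<le> g' r" if "r \<in> {b..c}" for r
        using that g0[of r] bc by (auto simp: g'_def)
      have "integral {0..s} F + integral {s..s'} F = integral {0..s'} F"
        by (rule Henstock_Kurzweil_Integration.integral_combine)
          (use bc s in \<open>auto intro: integrable_on_subinterval[OF F]\<close>)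
      then have "D s' - D s = integral {s..s'} F"
        using D[of s] D[of s'] bc s by (simp add: algebra_simps)
      also have "\<dots> = integral {s..s'} F'"
        by (rule integral_spike[OF N]) (auto simp: F'_def)
      finally have "norm (D s' - D s) = norm (integral {s..s'} F')" by simp
      also have "\<dots> \<le> integral {s..s'} (\<lambda>r. g' r * norm (D m))"
      proof (rule integral_norm_bound_integral[OF Fi])
        show "(\<lambda>r. g' r * norm (D m)) integrable_on {s..s'}"
          by (rule integrable_on_mult_left[OF gi'])
        fix r assume r: "r \<in> {s..s'}"
        show "norm (F' r) \<le> g' r * norm (D m)"
        proof (cases "r \<in> N")
          case False
          then have "norm (F r) \<le> g r * norm (D r)" "0 \<le> g r"
            using r s bc by (auto intro!: bound g0)
          moreover have "norm (D r) \<le> norm (D m)" using r s by (intro m) auto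
          ultimately show ?thesis
            using False by (auto simp: F'_def g'_def intro: order_trans mult_left_mono)
        qed (simp add: F'_def g'_def)
      qed
      also have "\<dots> = integral {s..s'} g' * norm (D m)" by simp
      also have "\<dots> \<le> integral {b..c} g' * norm (D m)"
        using s gi gi' g'0 by (intro mult_right_mono integral_subset_le) auto
      also have "integral {b..c} g' = integral {b..c} g"
        by (rule integral_spike[OF N]) (auto simp: g'_def)
      also have "integral {b..c} g * norm (D m) \<le> 1 / 2 * norm (D m)"
        using half by (intro mult_right_mono) auto
      finally show ?thesis by simp
    qed
    have "norm (D m) \<le> 2 * norm (D b)"
      using incr[of b m] m(1) norm_triangle_ineq2[of "D m" "D b"] by auto
    moreover have "norm (D m) \<le> 2 * norm (D c)"
      using incr[of m c] m(1) norm_triangle_ineq2[of "D m" "D c"]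
      by (auto simp: norm_minus_commute)
    ultimately show ?thesis using m(2)[of b] m(2)[of c] bc by auto
  qed
  have "norm (D (real k * t / real n)) \<le> 2 ^ k * norm (D 0) \<and>
      norm (D 0) \<le> 2 ^ k * norm (D (real k * t / real n))" if "k \<le> n" for k
    using that
  proof (induction k)
    case (Suc k)
    define b where "b = real k * t / real n"
    define c where "c = real (Suc k) * t / real n"
    have "b \<le> c" unfolding b_def c_def
      using t n by (intro divide_right_mono mult_right_mono) auto
    moreover have "c \<le> t" using t n Suc.prems
      by (auto simp: c_def divide_le_eq mult.commute intro!: mult_left_mono simp del: of_nat_Suc)
    moreover have "0 \<le> b" using t by (simp add: b_def)
    moreover have "integral {b..c} g \<le> 1 / 2" using small[of k] Suc.prems by (simp add: b_def c_def)
    ultimately have step: "norm (D c) \<le> 2 * norm (D b)" "norm (D b) \<le> 2 * norm (D c)"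
      using local[of b c] by auto
    then have "2 ^ k * norm (D b) \<le> 2 ^ k * (2 * norm (D c))"
      by (intro mult_left_mono) auto
    moreover have "norm (D b) \<le> 2 ^ k * norm (D 0)" "norm (D 0) \<le> 2 ^ k * norm (D b)"
      using Suc by (auto simp: b_def)
    ultimately have "norm (D c) \<le> 2 ^ Suc k * norm (D 0)" "norm (D 0) \<le> 2 ^ Suc k * norm (D c)"
      using step(1) unfolding power_Suc by linarith+
    then show ?case unfolding c_def by blast
  qed simp
  from this[of n] show ?thesis using n by simp
qed

text \<open>Uniform continuity of the indefinite integral on a compact interval.\<close>

lemma integral_small_pieces:
  fixes g :: "real \<Rightarrow> real"
  assumes t: "0 \<le> t" and g: "g integrable_on {0..t}" and e: "e > 0"
  obtains n where "n > 0"
    "\<And>k. k < n \<Longrightarrow> integral {real k * t / real n .. real (Suc k) * t / real n} g \<le> e"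
proof -
  define G where "G = (\<lambda>s. integral {0..s} g)"
  have "uniformly_continuous_on {0..t} G" unfolding G_def
    by (intro compact_uniformly_continuous indefinite_integral_continuous_1 g) auto
  then obtain d where d: "d > 0"
    "\<And>x y. x \<in> {0..t} \<Longrightarrow> y \<in> {0..t} \<Longrightarrow> dist y x < d \<Longrightarrow> dist (G y) (G x) < e"
    using e unfolding uniformly_continuous_on_def by metis
  obtain n where n: "real n > t / d" using reals_Archimedean2 by blast
  moreover have "t / d \<ge> 0" using t d by simp
  ultimately have n0: "n > 0" by (cases n) auto
  have "integral {real k * t / real n .. real (Suc k) * t / real n} g \<le> e" if k: "k < n" for k
  proof -
    define b where "b = real k * t / real n"
    define c where "c = real (Suc k) * t / real n"
    have cb: "c - b = t / real n" by (simp add: b_def c_def field_simps add_divide_distrib)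
    have "t / real n < d" using n n0 d by (simp add: field_simps)
    moreover have b: "b \<le> c" using cb t by (simp add: algebra_simps) 
    moreover have "c \<le> t" using t n0 k
      by (auto simp: c_def divide_le_eq mult.commute intro!: mult_left_mono simp del: of_nat_Suc)
    moreover have "0 \<le> b" using t by (simp add: b_def)
    ultimately have "dist (G c) (G b) < e" using cb by (intro d) (auto simp: dist_real_def)
    moreover have "integral {0..b} g + integral {b..c} g = integral {0..c} g"
      by (rule Henstock_Kurzweil_Integration.integral_combine)
        (use b \<open>c \<le> t\<close> \<open>0 \<le> b\<close> in \<open>auto intro: integrable_on_subinterval[OF g]\<close>)
    ultimately show ?thesis unfolding b_def[symmetric] c_def[symmetric]
      by (simp add: G_def dist_real_def)
  qed
  then show ?thesis using that n0 by blast
qed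

text \<open>The difference of two trajectories is an integral curve of
  \<open>u (\<phi> x s) s - u (\<phi> y s) s\<close>, whose norm is at most \<open>g s\<close> times the distance of the trajectories.
  The number of intervals depends on \<open>g\<close> and \<open>t\<close> only, which makes the constant uniform in the
  starting points.\<close>

lemma flow_bilipschitz:
  fixes u \<phi> :: "real^'n \<Rightarrow> real \<Rightarrow> real^'n"
  assumes u: "u \<in> L1_Lip T" and \<phi>: "particle_trajectory_map T u \<phi>" and t: "t \<in> {0..<T}"
  obtains C where "C > 0" "\<And>x y. norm (x - y) \<le> C * norm (\<phi> x t - \<phi> y t)"
    "\<And>x y. norm (\<phi> x t - \<phi> y t) \<le> C * norm (x - y)"
proof -
  obtain g N where g: "g integrable_on {0..T}" "negligible N"
    "\<And>s. s \<in> {0..T} - N \<Longrightarrow> 0 \<le> g s"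
    "\<And>s x y. s \<in> {0..T} - N \<Longrightarrow> norm (u x s - u y s) \<le> g s * norm (x - y)"
    using L1_Lip_majorant[OF u] by blast
  have t0: "0 \<le> t" using t by simp
  have gt: "g integrable_on {0..t}"
    by (rule integrable_on_subinterval[OF g(1)]) (use t in auto)
  obtain n where n: "n > 0"
    "\<And>k. k < n \<Longrightarrow> integral {real k * t / real n .. real (Suc k) * t / real n} g \<le> 1 / 2"
    using integral_small_pieces[OF t0 gt, of "1/2"] by (metis half_gt_zero_iff zero_less_one)
  have int: "(\<lambda>r. u (\<phi> x r) r) integrable_on {0..s}"
    and traj: "\<phi> x s = x + integral {0..s} (\<lambda>r. u (\<phi> x r) r)" if "s \<in> {0..t}" for x s
    using \<phi> that t unfolding particle_trajectory_map_def
    by (auto dest!: spec[of _ x] bspec[of _ _ s] simp: absolutely_integrable_on_def)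
  have init: "\<phi> x 0 = x" for x using traj[of 0 x] t0 by simp
  have both: "norm (\<phi> x t - \<phi> y t) \<le> 2 ^ n * norm (x - y)"
    "norm (x - y) \<le> 2 ^ n * norm (\<phi> x t - \<phi> y t)" for x y
  proof -
    have "norm (\<phi> x t - \<phi> y t) \<le> 2 ^ n * norm (\<phi> x 0 - \<phi> y 0) \<and>
      norm (\<phi> x 0 - \<phi> y 0) \<le> 2 ^ n * norm (\<phi> x t - \<phi> y t)"
    proof (rule norm_comparable_along_integral_curve[OF t0 g(2) gt, where D = "\<lambda>s. \<phi> x s - \<phi> y s"
          and F = "\<lambda>s. u (\<phi> x s) s - u (\<phi> y s) s" and n = n])
      show "(\<lambda>s. u (\<phi> x s) s - u (\<phi> y s) s) integrable_on {0..t}"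
        using int[of t] t0 by (intro integrable_diff) auto
      show "\<phi> x s - \<phi> y s = \<phi> x 0 - \<phi> y 0 + integral {0..s} (\<lambda>s. u (\<phi> x s) s - u (\<phi> y s) s)"
        if "s \<in> {0..t}" for s
        using that int[OF that] traj[OF that, of x] traj[OF that, of y]
        by (simp add: init Henstock_Kurzweil_Integration.integral_diff)
    qed (use g n t in auto)
    then show "norm (\<phi> x t - \<phi> y t) \<le> 2 ^ n * norm (x - y)"
      "norm (x - y) \<le> 2 ^ n * norm (\<phi> x t - \<phi> y t)" by (auto simp: init)
  qed
  show ?thesis by (rule that[of "2 ^ n"]) (use both in auto)
qed


section \<open>Conservation of the logarithmic seminorms\<close>


theorem theorem1p1:
  fixes T \<gamma> :: real
    and u \<phi> :: "real^'n \<Rightarrow> real \<Rightarrow> real^'n"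
    and \<theta> :: "real^'n \<Rightarrow> real \<Rightarrow> real"
    and \<theta>0 :: "real^'n \<Rightarrow> real"
    and x0 :: "real^'n"
  assumes "T > 0"
    and "u \<in> L1_Lip T"
    and "particle_trajectory_map T u \<phi>"
    and "\<theta> \<in> L_infty_L_infty T"
    and "transported_solution T \<phi> \<theta>0 \<theta>"
    and "\<gamma> > 0"
    and "\<theta>0 \<in> pt_modulus_space (log_modulus \<gamma>) x0"
  shows "(\<forall>t\<in>{0..<T}.
            pt_seminorm (log_modulus \<gamma>) (\<lambda>x. \<theta> x t) (\<phi> x0 t)
              = pt_seminorm (log_modulus \<gamma>) \<theta>0 x0) \<and>
         (\<forall>t\<in>{0..<T}.
            (SUP x. pt_seminorm (log_modulus \<gamma>) (\<lambda>x. \<theta> x t) x)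
              = (SUP x. pt_seminorm (log_modulus \<gamma>) \<theta>0 x))"
proof -
  have flow: "surj (\<lambda>x. \<phi> x t)"
    "pt_seminorm (log_modulus \<gamma>) (\<lambda>x. \<theta> x t) (\<phi> x t) = pt_seminorm (log_modulus \<gamma>) \<theta>0 x"
    if t: "t \<in> {0..<T}" for t x
  proof -
    obtain C where C: "C > 0" "\<And>x y. norm (x - y) \<le> C * norm (\<phi> x t - \<phi> y t)"
      "\<And>x y. norm (\<phi> x t - \<phi> y t) \<le> C * norm (x - y)"
      using flow_bilipschitz[OF assms(2,3) t] by blast
    show surj: "surj (\<lambda>x. \<phi> x t)" by (rule bilipschitz_imp_surj[OF C(2,3)])
    show "pt_seminorm (log_modulus \<gamma>) (\<lambda>x. \<theta> x t) (\<phi> x t) = pt_seminorm (log_modulus \<gamma>) \<theta>0 x"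
    proof (rule pt_seminorm_log_modulus_bilipschitz[OF _ C(1) surj C(2,3)])
      show "\<gamma> \<ge> 0" using assms(6) by simp
      show "\<theta> (\<phi> x t) t = \<theta>0 x" for x
        using assms(5) t by (auto simp: transported_solution_def)
    qed
  qed
  have "(SUP x. pt_seminorm (log_modulus \<gamma>) (\<lambda>x. \<theta> x t) x)
      = (SUP x. pt_seminorm (log_modulus \<gamma>) \<theta>0 x)" if t: "t \<in> {0..<T}" for t
  proof -
    have "(SUP y. pt_seminorm (log_modulus \<gamma>) (\<lambda>x. \<theta> x t) y)
        = (SUP y\<in>range (\<lambda>x. \<phi> x t). pt_seminorm (log_modulus \<gamma>) (\<lambda>x. \<theta> x t) y)"
      using flow(1)[OF t] by simp
    also have "\<dots> = (SUP x. pt_seminorm (log_modulus \<gamma>) \<theta>0 x)"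
      by (simp add: image_image flow(2)[OF t])
    finally show ?thesis .
  qed
  then show ?thesis using flow(2) by blast
qed

end
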